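(* Let $W_1(x)=(1-x^2)^{\frac12}\begin{pmatrix}4x^2+2&3\sqrt2\,x\\3\sqrt2\,x&x^2+2\end{pmatrix}$ on $(-1,1)$ and let $\{P_{n,1}\}_{n\ge0}$ be the sequence of monic matrix orthogonal polynomials with respect to $W_1$. Then for every $n\ge0$ the Rodrigues' formula $$P_{n,1}(x)=c\left[(1-x^2)^{\frac12+n}\left(\begin{pmatrix}4x^2+2&3\sqrt2\,x\\3\sqrt2\,x&x^2+2\end{pmatrix}+\begin{pmatrix}\frac{2n}{n+2}&\frac{\sqrt2\,n x}{n+2}\\-\frac{\sqrt2\,n x}{n+1}&-\frac{n}{n+1}\end{pmatrix}\right)\right]^{(n)}W_1(x)^{-1}$$ holds for $x\in(-1,1)$, where $[\,\cdot\,]^{(n)}$ is the $n$-th derivative in $x$ and $$c=\frac{(-1)^n2^{-2n-2}(n+2)(n+3)\sqrt\pi}{(2n+3)\,\Gamma(n+\frac32)}.$$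
   Context: The monic matrix orthogonal polynomials with respect to $W_1$ are the unique $2\times2$ matrix polynomials $P_{n,1}$ of degree $n$ with leading coefficient the identity and $\int_{-1}^1P_{n,1}(x)W_1(x)P_{m,1}(x)^*dx=0$ for $n\ne m$. *)

theory Defs
  imports "HOL-Analysis.Analysis" "HOL-Computational_Algebra.Polynomial"
begin

text \<open>
  Matrix polynomials are matrices of polynomials. (The type \<open>(complex^'n^'n) poly\<close> would be
  wrong here: the product that the library puts on the type \<open>complex^'n^'n\<close> is
  componentwise.)
\<close>

type_synonym 'n mpoly = "complex poly ^ 'n ^ 'n"

definition meval :: "'n::finite mpoly \<Rightarrow> real \<Rightarrow> complex ^ 'n ^ 'n" where
  "meval P x = map_matrix (\<lambda>p. poly p (complex_of_real x)) P"

definition mcoeff :: "'n::finite mpoly \<Rightarrow> nat \<Rightarrow> complex ^ 'n ^ 'n" where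
  "mcoeff P k = map_matrix (\<lambda>p. coeff p k) P"

definition monic_of_degree :: "nat \<Rightarrow> 'n::finite mpoly \<Rightarrow> bool" where
  "monic_of_degree n P \<longleftrightarrow> mcoeff P n = mat 1 \<and> (\<forall>k>n. mcoeff P k = 0)"

definition conj_transpose :: "complex ^ 'n ^ 'm \<Rightarrow> complex ^ 'm ^ 'n" where
  "conj_transpose A = map_matrix cnj (transpose A)"

definition monic_MOPs ::
    "real set \<Rightarrow> (real \<Rightarrow> complex ^ 'n ^ 'n) \<Rightarrow> (nat \<Rightarrow> 'n::finite mpoly) \<Rightarrow> bool" where
  "monic_MOPs I W P \<longleftrightarrow>
     (\<forall>n. monic_of_degree n (P n)) \<and>
     (\<forall>n m. n \<noteq> m \<longrightarrow>
        ((\<lambda>x. meval (P n) x ** W x ** conj_transpose (meval (P m) x)) has_integral 0) I)"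

definition nth_derivative ::
    "nat \<Rightarrow> (real \<Rightarrow> 'a::real_normed_vector) \<Rightarrow> real \<Rightarrow> 'a" where
  "nth_derivative n f = ((\<lambda>g t. vector_derivative g (at t)) ^^ n) f"

definition cmat2 :: "real \<Rightarrow> real \<Rightarrow> real \<Rightarrow> real \<Rightarrow> complex ^ 2 ^ 2" where
  "cmat2 a b c d = map_matrix complex_of_real (vector [vector [a, b], vector [c, d]])"

definition M1 :: "real \<Rightarrow> complex ^ 2 ^ 2" where
  "M1 x = cmat2 (4 * x\<^sup>2 + 2) (3 * sqrt 2 * x)
                (3 * sqrt 2 * x) (x\<^sup>2 + 2)"

definition W1 :: "real \<Rightarrow> complex ^ 2 ^ 2" where
  "W1 x = ((1 - x\<^sup>2) powr (1/2)) *\<^sub>R M1 x"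

end

theory Submission
  imports Defs
begin

text \<open>
  Put \<open>x = cos \<theta>\<close> and let \<open>U\<^sub>k\<close> be the Chebyshev polynomials of the second kind, so that
  \<open>sqrt (1 - x\<^sup>2) U\<^sub>k(x) = sin ((k + 1) \<theta>)\<close>. These are the orthogonal polynomials of the scalar weight
  \<open>sqrt (1 - x\<^sup>2)\<close> that \<open>W1\<close> contains. The proof computes both \<open>P\<^sub>n W1\<close> and the \<open>n\<close>-th derivative in
  the formula as explicit combinations of \<open>sin ((n + 1) \<theta>)\<close>, \<open>sin ((n + 2) \<theta>)\<close>, \<open>sin ((n + 3) \<theta>)\<close>,
  compares them, and cancels the invertible matrix \<open>W1 x\<close>.

  For \<open>P\<^sub>n W1\<close>: orthogonality to \<open>P\<^sub>0, \<dots>, P\<^sub>n\<^sub>-\<^sub>1\<close> means that all moments of \<open>P\<^sub>n W1\<close> of order below \<open>n\<close>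
  vanish (\<open>monic_MOPs_moments\<close>). The entries of \<open>P\<^sub>n M1\<close> are polynomials of degree at most \<open>n + 2\<close>, so
  they are combinations of \<open>U\<^sub>n, U\<^sub>n\<^sub>+\<^sub>1, U\<^sub>n\<^sub>+\<^sub>2\<close> only (\<open>chebyshev_U_expansion_of_orthogonal\<close>). The
  coefficients of \<open>U\<^sub>n\<^sub>+\<^sub>2\<close> are known since \<open>P\<^sub>n\<close> is monic. The other four in each row follow from the
  degeneration of \<open>M1\<close> at the end points: its determinant is \<open>4 (1 - x\<^sup>2)\<^sup>2\<close>, so that a row which
  is a polynomial multiple of \<open>M1\<close> satisfies two linear conditions, one on values and one on first
  derivatives, at each of \<open>1\<close> and \<open>-1\<close> (\<open>M1_product_boundary\<close>). This system determines the
  coefficients (\<open>chebyshev_U_coefficients\<close>) and gives \<open>monic_MOPs_W1_chebyshev\<close>.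

  For the derivative: the differentiated matrix is \<open>f\<close>, \<open>t f\<close>, \<open>t\<^sup>2 f\<close> times constant matrices, with
  \<open>f = (1 - t\<^sup>2)\<^bsup>n + 1/2\<^esup>\<close>. The classical Rodrigues formula \<open>f\<^sup>(\<^sup>n\<^sup>) = \<gamma>\<^sub>n sin ((n + 1) \<theta>)\<close>
  (\<open>rodrigues_chebyshev\<close>) and its variants for \<open>t f\<close> and \<open>t\<^sup>2 f\<close> come from two ways of
  differentiating \<open>(1 - t\<^sup>2)\<^bsup>n + 3/2\<^esup>\<close>: by the chain rule, and as a product with the factor \<open>1 - t\<^sup>2\<close>.
\<close>

section \<open>Iterated derivatives\<close>

text \<open>
  All derivatives of \<open>h 0\<close> on \<open>S\<close> at once. Exhibiting such a sequence replaces differentiability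
  arguments about iterated derivatives by a check of one first derivative, and two sequences that
  start with the same function can be compared term by term.
\<close>

definition derivative_sequence ::
    "real set \<Rightarrow> (nat \<Rightarrow> real \<Rightarrow> 'a::real_normed_vector) \<Rightarrow> bool" where
  "derivative_sequence S h \<longleftrightarrow>
     (\<forall>k. \<forall>x\<in>S. (h k has_vector_derivative h (Suc k) x) (at x))"

lemma nth_derivative_eq_derivative_sequence:
  assumes "open S" "derivative_sequence S h" "\<And>x. x \<in> S \<Longrightarrow> f x = h 0 x" "x \<in> S"
  shows "nth_derivative k f x = h k x"
  using \<open>x \<in> S\<close>
proof (induction k arbitrary: x)
  case 0
  then show ?case using assms(3) by (simp add: nth_derivative_def)
next
  case (Suc k)
  have "(h k has_vector_derivative h (Suc k) x) (at x)"
    using assms(2) Suc.prems by (simp add: derivative_sequence_def)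
  then have "(nth_derivative k f has_vector_derivative h (Suc k) x) (at x)"
    by (rule has_vector_derivative_transform_within_open[OF _ \<open>open S\<close> Suc.prems])
      (simp add: Suc.IH)
  then show ?case
    by (simp add: nth_derivative_def vector_derivative_at)
qed

lemma derivative_sequence_unique:
  assumes "open S" "derivative_sequence S h" "derivative_sequence S h'"
    and "\<And>x. x \<in> S \<Longrightarrow> h 0 x = h' 0 x" "x \<in> S"
  shows "h k x = h' k x"
  using nth_derivative_eq_derivative_sequence[OF assms(1,2), of "h 0" x k]
    nth_derivative_eq_derivative_sequence[OF assms(1,3), of "h 0" x k] assms(4,5)
  by simp

text \<open>
  The Leibniz rule for a product with the identity function: if \<open>h\<close> lists the derivatives of \<open>h 0\<close>,
  this lists those of \<open>\<lambda>t. t * h 0 t\<close>. At \<open>k = 0\<close> the truncated index \<open>k - 1\<close> is harmless because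
  of the factor \<open>k\<close>.
\<close>

definition times_id :: "(nat \<Rightarrow> real \<Rightarrow> real) \<Rightarrow> nat \<Rightarrow> real \<Rightarrow> real" where
  "times_id h k t = t * h k t + real k * h (k - 1) t"

lemma derivative_sequence_times_id:
  assumes "derivative_sequence S h"
  shows "derivative_sequence S (times_id h)"
  unfolding derivative_sequence_def
proof (intro allI ballI)
  fix k x assume "x \<in> S"
  then have [derivative_intros]: "(h j has_field_derivative h (Suc j) x) (at x)" for j
    using assms by (simp add: derivative_sequence_def has_real_derivative_iff_has_vector_derivative)
  show "(times_id h k has_vector_derivative times_id h (Suc k) x) (at x)"
    unfolding has_real_derivative_iff_has_vector_derivative[symmetric] times_id_def
    by (cases k) (auto intro!: derivative_eq_intros simp: algebra_simps)
qed

section \<open>Rodrigues formulas for powers of 1 - t^2\<close>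

text \<open>
  The derivatives of \<open>(1 - t\<^sup>2) powr a\<close>. The recursion reads
  \<open>D\<^bsup>k+1\<^esup> (1 - t\<^sup>2)\<^sup>a = - 2 a D\<^sup>k (t (1 - t\<^sup>2)\<^bsup>a-1\<^esup>)\<close>, which is the chain rule followed by the
  Leibniz rule above; it trades one derivative for one unit of the exponent, which is the step
  that relates the functions \<open>D\<^sup>n (1 - t\<^sup>2)\<^bsup>n+1/2\<^esup>\<close> for consecutive \<open>n\<close>.
\<close>

fun power_deriv :: "real \<Rightarrow> nat \<Rightarrow> real \<Rightarrow> real" where
  "power_deriv a 0 t = (1 - t\<^sup>2) powr a"
| "power_deriv a (Suc k) t =
     - 2 * a * (t * power_deriv (a - 1) k t + real k * power_deriv (a - 1) (k - 1) t)"

declare power_deriv.simps(2) [simp del]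

lemma power_deriv_Suc_eq:
  "power_deriv a (Suc k) t = - 2 * a * times_id (power_deriv (a - 1)) k t"
  by (simp add: times_id_def power_deriv.simps(2))

lemma power_deriv_has_derivative:
  assumes "x \<in> {-1<..<1}"
  shows "(power_deriv a k has_real_derivative power_deriv a (Suc k) x) (at x)"
proof (induction k arbitrary: a rule: less_induct)
  case (less k)
  have pos: "1 - x\<^sup>2 > 0"
    using assms by (simp add: abs_square_less_1 abs_less_iff)
  show ?case
  proof (cases k)
    case 0
    have "((\<lambda>t. (1 - t\<^sup>2) powr a) has_real_derivative - 2 * a * (x * (1 - x\<^sup>2) powr (a - 1))) (at x)"
      using pos by (auto intro!: derivative_eq_intros simp: field_simps)
    then show ?thesis using 0 by (simp add: power_deriv.simps(2))
  next
    case (Suc j)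
    have 1: "(power_deriv (a - 1) j has_real_derivative power_deriv (a - 1) (Suc j) x) (at x)"
      using less Suc by simp
    have 2: "((\<lambda>t. real j * power_deriv (a - 1) (j - 1) t) has_real_derivative
              real j * power_deriv (a - 1) j x) (at x)"
    proof (cases j)
      case (Suc i)
      then show ?thesis
        using DERIV_cmult[OF less[of i "a - 1"], of "real j"] \<open>k = Suc j\<close> by simp
    qed simp
    have "((\<lambda>t. - 2 * a * (t * power_deriv (a - 1) j t
              + real j * power_deriv (a - 1) (j - 1) t)) has_real_derivative
            - 2 * a * (1 * power_deriv (a - 1) j x + power_deriv (a - 1) (Suc j) x * x
              + real j * power_deriv (a - 1) j x)) (at x)"
      by (intro DERIV_cmult DERIV_add DERIV_mult DERIV_ident 1 2)
    moreover have "- 2 * a * (1 * power_deriv (a - 1) j x + power_deriv (a - 1) (Suc j) x * x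
              + real j * power_deriv (a - 1) j x) = power_deriv a (Suc (Suc j)) x"
      unfolding power_deriv.simps(2)[of a "Suc j"] by (simp add: algebra_simps)
    moreover have "power_deriv a (Suc j) = (\<lambda>t. - 2 * a * (t * power_deriv (a - 1) j t
              + real j * power_deriv (a - 1) (j - 1) t))"
      by (rule ext) (rule power_deriv.simps(2))
    ultimately show ?thesis unfolding Suc by (simp only:)
  qed
qed

lemma derivative_sequence_power_deriv:
  "derivative_sequence {-1<..<1} (power_deriv a)"
  unfolding derivative_sequence_def has_real_derivative_iff_has_vector_derivative[symmetric]
  using power_deriv_has_derivative by blast

text \<open>
  The second relation between the exponents \<open>a\<close> and \<open>a + 1\<close>: differentiate
  \<open>(1 - t\<^sup>2)\<^bsup>a+1\<^esup> = (1 - t\<^sup>2)\<^sup>a - t\<^sup>2 (1 - t\<^sup>2)\<^sup>a\<close>.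
\<close>

lemma power_deriv_add_one:
  assumes "t \<in> {-1<..<1}"
  shows "power_deriv (a + 1) k t =
    power_deriv a k t - times_id (times_id (power_deriv a)) k t"
proof (rule derivative_sequence_unique[OF _ _ _ _ assms,
      of "power_deriv (a + 1)" "\<lambda>k t. power_deriv a k t - times_id (times_id (power_deriv a)) k t"])
  show "derivative_sequence {-1<..<1} (\<lambda>k t. power_deriv a k t - times_id (times_id (power_deriv a)) k t)"
    using derivative_sequence_power_deriv[of a]
      derivative_sequence_times_id[OF derivative_sequence_times_id[OF derivative_sequence_power_deriv[of a]]]
    unfolding derivative_sequence_def by (auto intro!: has_vector_derivative_diff)
next
  fix x :: real assume "x \<in> {-1<..<1}"
  then have "1 - x\<^sup>2 > 0"
    by (simp add: abs_square_less_1 abs_less_iff)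
  then show "power_deriv (a + 1) 0 x = power_deriv a 0 x - times_id (times_id (power_deriv a)) 0 x"
    by (simp add: times_id_def powr_add algebra_simps power2_eq_square)
qed (simp_all add: derivative_sequence_power_deriv)

text \<open>
  The constant of the classical Rodrigues formula,
  \<open>(-1)\<^sup>n (2 n + 1)!! / (n + 1)\<close>, with the double factorial written through the Gamma function.
\<close>

definition rodrigues_const :: "nat \<Rightarrow> real" where
  "rodrigues_const n = (-1) ^ n * 2 ^ (n + 1) * Gamma (real n + 3/2) / (sqrt pi * (real n + 1))"

lemma pos_not_nonpos_Int: "(a::real) > 0 \<Longrightarrow> a \<notin> \<int>\<^sub>\<le>\<^sub>0"
  by (auto simp: nonpos_Ints_def)

lemma rodrigues_const_0: "rodrigues_const 0 = 1"
proof -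
  have "(1/2 :: real) \<notin> \<int>\<^sub>\<le>\<^sub>0"
    using pos_not_nonpos_Int[of "1/2"] by simp
  then have "Gamma (3/2 :: real) = 1/2 * Gamma (1/2)"
    using Gamma_plus1[of "1/2 :: real"] by simp
  then show ?thesis by (simp add: rodrigues_const_def Gamma_one_half_real)
qed

lemma rodrigues_const_Suc:
  "(real n + 2) * rodrigues_const (Suc n) = - (real n + 1) * (2 * real n + 3) * rodrigues_const n"
proof -
  have "Gamma (real n + 3/2 + 1) = (real n + 3/2) * Gamma (real n + 3/2)"
    by (rule Gamma_plus1, rule pos_not_nonpos_Int) simp
  moreover have "real (Suc n) + 3/2 = real n + 3/2 + 1" by simp
  ultimately have *: "Gamma (real (Suc n) + 3/2) = (real n + 3/2) * Gamma (real n + 3/2)" by metis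
  define G where "G = Gamma (real n + 3/2)"
  define c where "c = (-1) ^ n * 2 ^ n / sqrt pi * G"
  have "rodrigues_const n = 2 * c / (real n + 1)"
    unfolding rodrigues_const_def G_def[symmetric] c_def by simp
  then have "(real n + 1) * rodrigues_const n = 2 * c" by simp
  moreover have "rodrigues_const (Suc n) = - 4 * (real n + 3/2) * c / (real n + 2)"
    unfolding rodrigues_const_def * G_def[symmetric] c_def by (simp add: algebra_simps add_divide_distrib diff_divide_distrib)
  then have "(real n + 2) * rodrigues_const (Suc n) = - 4 * (real n + 3/2) * c" by simp
  then have "(real n + 2) * rodrigues_const (Suc n) = - (2 * real n + 3) * (2 * c)"
    by (simp add: algebra_simps)
  ultimately have "(real n + 2) * rodrigues_const (Suc n) =
      - (2 * real n + 3) * ((real n + 1) * rodrigues_const n)" by simp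
  then show ?thesis by (simp only: mult_ac mult_minus_left mult_minus_right)
qed

text \<open>
  Write \<open>E\<^sub>n\<close> for the left-hand side. Eliminating the derivative of order \<open>n - 1\<close> between the two
  relations for the exponents \<open>n + 1/2\<close> and \<open>n + 3/2\<close> leaves
  \<open>(n + 2) E\<^sub>n\<^sub>+\<^sub>1 = (2 n + 3) ((1 - t\<^sup>2) E\<^sub>n' - (n + 1) t E\<^sub>n)\<close>. With \<open>t = cos \<theta>\<close> the bracket turns
  \<open>sin ((n + 1) \<theta>)\<close> into \<open>- (n + 1) sin ((n + 2) \<theta>)\<close> by the addition theorem.
\<close>

lemma rodrigues_chebyshev:
  assumes "t \<in> {-1<..<1}"
  shows "power_deriv (1/2 + real n) n t = rodrigues_const n * sin (real (n + 1) * arccos t)"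
  using assms
proof (induction n arbitrary: t)
  case 0
  then show ?case by (simp add: rodrigues_const_0 sin_arccos powr_half_sqrt abs_square_le_1 abs_le_iff)
next
  case (Suc n)
  define D where "D = power_deriv (1/2 + real n)"
  have pos: "1 - t\<^sup>2 > 0"
    using Suc.prems by (simp add: abs_square_less_1 abs_less_iff)
  define r where "r = sqrt (1 - t\<^sup>2)"
  have r: "r > 0" "r * r = 1 - t\<^sup>2" using pos by (auto simp: r_def)
  have th: "sin (arccos t) = r" "cos (arccos t) = t"
    using Suc.prems by (simp_all add: r_def sin_arccos)
  let ?s = "sin (real (n + 1) * arccos t)" and ?c = "cos (real (n + 1) * arccos t)"
  have 1: "D n t = rodrigues_const n * ?s" unfolding D_def by (rule Suc.IH[OF Suc.prems])
  have "((\<lambda>t. rodrigues_const n * sin (real (n + 1) * arccos t)) has_real_derivative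
     - rodrigues_const n * real (n + 1) * ?c / r) (at t)"
    using Suc.prems r unfolding r_def by (auto intro!: derivative_eq_intros simp: field_simps)
  moreover have "(D n has_real_derivative D (Suc n) t) (at t)"
    unfolding D_def by (rule power_deriv_has_derivative[OF Suc.prems])
  then have "((\<lambda>t. rodrigues_const n * sin (real (n + 1) * arccos t)) has_real_derivative D (Suc n) t) (at t)"
    by (rule DERIV_cong_ev[THEN iffD1, rotated -1])
      (use Suc in \<open>auto simp: D_def intro!: eventually_mono[OF eventually_nhds_in_open[of "{-1<..<1}"]]\<close>)
  ultimately have "D (Suc n) t = - rodrigues_const n * real (n + 1) * ?c / r"
    by (rule DERIV_unique[symmetric])
  then have "r * D (Suc n) t = - rodrigues_const n * real (n + 1) * ?c" using r by simp
  then have 2: "(1 - t\<^sup>2) * D (Suc n) t = - rodrigues_const n * real (n + 1) * (r * ?c)"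
    by (metis mult.assoc mult.left_commute r(2))
  \<comment> \<open>The two relations between \<open>e = E\<^sub>n\<^sub>+\<^sub>1\<close> and the derivatives of \<open>(1 - t\<^sup>2)\<^bsup>n+1/2\<^esup>\<close> (facts 3 and 4).\<close>
  define e where "e = power_deriv (1/2 + real (Suc n)) (Suc n) t"
  have 3: "e = - (2 * real n + 3) * (t * D n t + real n * D (n - 1) t)"
    unfolding e_def power_deriv_Suc_eq times_id_def D_def by (simp add: algebra_simps)
  have "e = power_deriv (1/2 + real n + 1) (Suc n) t" by (simp add: e_def add_ac)
  also have "\<dots> = D (Suc n) t - times_id (times_id D) (Suc n) t"
    unfolding D_def by (rule power_deriv_add_one[OF Suc.prems])
  also have "times_id (times_id D) (Suc n) t =
      t\<^sup>2 * D (Suc n) t + 2 * real (n + 1) * t * D n t + real n * real (n + 1) * D (n - 1) t"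
    by (simp add: times_id_def algebra_simps power2_eq_square)
  finally have 4: "e = (1 - t\<^sup>2) * D (Suc n) t - 2 * real (n + 1) * t * D n t
      - real n * real (n + 1) * D (n - 1) t" by (simp add: algebra_simps)
  define X where "X = t * D n t"
  define Y where "Y = real n * D (n - 1) t"
  define Z where "Z = (1 - t\<^sup>2) * D (Suc n) t"
  have e: "e = - (2 * real n + 3) * (X + Y)" "e = Z - 2 * (real n + 1) * X - (real n + 1) * Y"
    using 3 4 by (simp add: X_def Y_def) (simp add: 4 X_def Y_def Z_def algebra_simps)
  \<comment> \<open>The combination of the two relations in which \<open>Y\<close> cancels.\<close>
  have "(real n + 2) * e = (2 * real n + 3) * e - (real n + 1) * e"
    by (simp add: algebra_simps)
  also have "\<dots> = (2 * real n + 3) * (Z - 2 * (real n + 1) * X - (real n + 1) * Y)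
      - (real n + 1) * (- (2 * real n + 3) * (X + Y))"
    using e by metis
  also have "\<dots> = (2 * real n + 3) * (Z - (real n + 1) * X)"
    by (simp add: algebra_simps)
  also have "\<dots> = (2 * real n + 3) * ((1 - t\<^sup>2) * D (Suc n) t - real (n + 1) * t * D n t)"
    by (simp add: X_def Z_def)
  also have "\<dots> = - (real n + 1) * (2 * real n + 3) * rodrigues_const n * (r * ?c + t * ?s)"
    unfolding 1 2 by (simp add: algebra_simps)
  also have "r * ?c + t * ?s = sin (real (Suc n + 1) * arccos t)"
  proof -
    have "real (Suc n + 1) * arccos t = real (n + 1) * arccos t + arccos t" by (simp add: algebra_simps)
    then show ?thesis by (simp only: sin_add th) simp
  qed
  also have "- (real n + 1) * (2 * real n + 3) * rodrigues_const n * \<dots> =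
      (real n + 2) * (rodrigues_const (Suc n) * sin (real (Suc n + 1) * arccos t))"
    unfolding rodrigues_const_Suc[symmetric] by simp
  finally show ?case unfolding e_def by (simp)
qed

text \<open>
  Up to the factor \<open>- (2 n + 3)\<close>, \<open>t (1 - t\<^sup>2)\<^bsup>n+1/2\<^esup>\<close> is the first derivative of
  \<open>(1 - t\<^sup>2)\<^bsup>n+3/2\<^esup>\<close>, so this is the Rodrigues formula with \<open>n + 1\<close> in place of \<open>n\<close>.
\<close>

lemma rodrigues_times_id:
  assumes "t \<in> {-1<..<1}"
  shows "(real n + 2) * times_id (power_deriv (1/2 + real n)) n t =
    (real n + 1) * rodrigues_const n * sin (real (n + 2) * arccos t)"
proof -
  have "power_deriv (1/2 + real (Suc n)) (Suc n) t =
     - (2 * real n + 3) * times_id (power_deriv (1/2 + real n)) n t"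
    unfolding power_deriv_Suc_eq by (simp add: algebra_simps)
  then have "- (2 * real n + 3) * times_id (power_deriv (1/2 + real n)) n t =
      rodrigues_const (Suc n) * sin (real (n + 2) * arccos t)"
    using rodrigues_chebyshev[OF assms, of "Suc n"] by simp
  then have "(real n + 2) * (- (2 * real n + 3) * times_id (power_deriv (1/2 + real n)) n t) =
      (- (real n + 1) * (2 * real n + 3) * rodrigues_const n) * sin (real (n + 2) * arccos t)"
    unfolding rodrigues_const_Suc[symmetric] by simp
  then have "- (2 * real n + 3) * ((real n + 2) * times_id (power_deriv (1/2 + real n)) n t) =
      - (2 * real n + 3) * ((real n + 1) * rodrigues_const n * sin (real (n + 2) * arccos t))"
    by (simp add: algebra_simps)
  then show ?thesis by (subst (asm) mult_cancel_left) auto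
qed

text \<open>
  Let \<open>H\<close> be the \<open>n\<close>-th derivative of \<open>(1 - t\<^sup>2)\<^bsup>n+3/2\<^esup>\<close>. The wanted quantity is \<open>E\<^sub>n - H\<close>, and by
  the Leibniz rule it is also \<open>t\<close> times the preceding one plus a multiple of \<open>H\<close>; this linear
  relation determines it.
\<close>

lemma rodrigues_times_id_times_id:
  assumes "t \<in> {-1<..<1}"
  shows "2 * (real n + 2) * (real n + 3) * times_id (times_id (power_deriv (1/2 + real n))) n t =
    rodrigues_const n * ((real n + 3) * sin (real (n + 1) * arccos t)
      + (real n + 1) * (2 * real n + 3) * sin (real (n + 3) * arccos t))"
proof -
  define D where "D = power_deriv (1/2 + real n)"
  define H where "H = power_deriv (1/2 + real n + 1) n t"
  let ?s = "\<lambda>k. sin (real (n + k) * arccos t)"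
  have 1: "H = D n t - times_id (times_id D) n t"
    unfolding H_def D_def by (rule power_deriv_add_one[OF assms])
  have 2: "real n * H = - (2 * real n + 3) * (real n * times_id D (n - 1) t)"
  proof (cases n)
    case (Suc m)
    then show ?thesis unfolding H_def D_def
      by (simp only: power_deriv_Suc_eq) (simp add: algebra_simps)
  qed simp
  have 3: "times_id (times_id D) n t = t * times_id D n t + real n * times_id D (n - 1) t"
    by (simp add: times_id_def)
  have E: "D n t = rodrigues_const n * ?s 1" unfolding D_def by (rule rodrigues_chebyshev[OF assms])
  have T: "(real n + 2) * times_id D n t = (real n + 1) * rodrigues_const n * ?s 2"
    unfolding D_def by (rule rodrigues_times_id[OF assms])
  have S: "2 * (t * ?s 2) = ?s 1 + ?s 3"
  proof -
    have "real (n + 3) * arccos t = real (n + 2) * arccos t + arccos t"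
      "real (n + 1) * arccos t = real (n + 2) * arccos t - arccos t" by (simp_all add: algebra_simps)
    then show ?thesis using assms by (simp only: sin_add sin_diff) simp
  qed
  define X where "X = times_id (times_id D) n t"
  define Y where "Y = times_id D n t"
  define Z where "Z = real n * times_id D (n - 1) t"
  have "real n * (D n t - X) = - (2 * real n + 3) * (X - t * Y)"
    using 1 2 3 unfolding X_def Y_def by simp
  then have "(real n + 3) * X = (2 * real n + 3) * t * Y - real n * D n t" 
    by (simp add: algebra_simps)
  then have "2 * (real n + 2) * ((real n + 3) * X) = 2 * (real n + 2) * ((2 * real n + 3) * t * Y - real n * D n t)"
    by simp
  also have "\<dots> = (2 * real n + 3) * (2 * t * ((real n + 2) * Y)) - 2 * (real n + 2) * real n * D n t"
    by (simp add: algebra_simps)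
  also have "\<dots> = (2 * real n + 3) * (real n + 1) * rodrigues_const n * (2 * (t * ?s 2))
     - 2 * (real n + 2) * real n * rodrigues_const n * ?s 1"
    using T unfolding Y_def E by (simp add: algebra_simps)
  finally show ?thesis unfolding S X_def D_def by (simp add: algebra_simps)
qed

section \<open>Chebyshev polynomials of the second kind\<close>

fun chebyshev_U :: "nat \<Rightarrow> complex poly" where
  "chebyshev_U 0 = 1"
| "chebyshev_U (Suc 0) = [:0, 2:]"
| "chebyshev_U (Suc (Suc n)) = [:0, 2:] * chebyshev_U (Suc n) - chebyshev_U n"

lemma chebyshev_U_sin:
  "poly (chebyshev_U n) (complex_of_real (cos \<theta>)) * complex_of_real (sin \<theta>) =
   complex_of_real (sin (real (n + 1) * \<theta>))"
proof (induction n rule: chebyshev_U.induct)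
  case 1
  show ?case by simp
next
  case 2
  show ?case using sin_double[of \<theta>] by simp
next
  case (3 n)
  have "real (Suc (Suc n) + 1) * \<theta> = real (Suc n + 1) * \<theta> + \<theta>"
    and "real (n + 1) * \<theta> = real (Suc n + 1) * \<theta> - \<theta>" by (simp_all add: algebra_simps)
  then have "sin (real (Suc (Suc n) + 1) * \<theta>) =
      2 * cos \<theta> * sin (real (Suc n + 1) * \<theta>) - sin (real (n + 1) * \<theta>)"
    by (simp only: sin_add sin_diff) simp
  then have "complex_of_real (sin (real (Suc (Suc n) + 1) * \<theta>)) =
      2 * complex_of_real (cos \<theta>) * complex_of_real (sin (real (Suc n + 1) * \<theta>))
        - complex_of_real (sin (real (n + 1) * \<theta>))"
    by (simp only: of_real_diff of_real_mult of_real_numeral)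
  then show ?case unfolding 3[symmetric] by (simp add: algebra_simps)
qed

lemma chebyshev_U_arccos:
  assumes "x \<in> {-1<..<1}"
  shows "complex_of_real (sqrt (1 - x\<^sup>2)) * poly (chebyshev_U n) (complex_of_real x) =
    complex_of_real (sin (real (n + 1) * arccos x))"
  using chebyshev_U_sin[of n "arccos x"] assms by (simp add: sin_arccos mult.commute)

lemma degree_chebyshev_U_le: "degree (chebyshev_U n) \<le> n"
proof (induction n rule: chebyshev_U.induct)
  case (3 n)
  have "degree ([:0, 2:] * chebyshev_U (Suc n)) \<le> Suc (Suc n)"
    using degree_mult_le[of "[:0, 2 :: complex:]" "chebyshev_U (Suc n)"] 3 by simp
  then show ?case using 3 by (auto intro!: degree_diff_le)
qed simp_all

lemma coeff_chebyshev_U: "coeff (chebyshev_U n) n = 2 ^ n"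
proof (induction n rule: chebyshev_U.induct)
  case (3 n)
  have "coeff (chebyshev_U n) (Suc (Suc n)) = 0"
    using degree_chebyshev_U_le[of n] by (intro coeff_eq_0) simp
  then show ?case using 3 by simp
qed simp_all

text \<open>
  The values and first derivatives at the end points feed the boundary conditions that determine
  the coefficients of a row of \<open>P\<^sub>n M1\<close>.
\<close>

lemma poly_chebyshev_U_1: "poly (chebyshev_U n) 1 = of_nat n + 1"
  by (induction n rule: chebyshev_U.induct) (simp_all add: algebra_simps)

lemma poly_chebyshev_U_minus_1: "poly (chebyshev_U n) (-1) = (-1) ^ n * (of_nat n + 1)"
proof (induction n rule: chebyshev_U.induct)
  case (3 n)
  have "poly (chebyshev_U (Suc (Suc n))) (-1) = - 2 * poly (chebyshev_U (Suc n)) (-1) - poly (chebyshev_U n) (-1)"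
    by simp
  then show ?case unfolding 3 by (simp add: algebra_simps)
qed simp_all

lemma poly_pderiv_chebyshev_U_1:
  "3 * poly (pderiv (chebyshev_U n)) 1 = of_nat n * (of_nat n + 1) * (of_nat n + 2)"
proof (induction n rule: chebyshev_U.induct)
  case (3 n)
  have "3 * poly (pderiv (chebyshev_U (Suc (Suc n)))) 1 =
      2 * (3 * poly (pderiv (chebyshev_U (Suc n))) 1) - 3 * poly (pderiv (chebyshev_U n)) 1 + 6 * (of_nat n + 2)"
    by (simp add: pderiv_diff pderiv_mult pderiv_smult pderiv_pCons poly_chebyshev_U_1 algebra_simps)
  then show ?case unfolding 3 by (simp add: algebra_simps)
qed (simp_all add: pderiv_pCons)

lemma poly_pderiv_chebyshev_U_minus_1:
  "3 * poly (pderiv (chebyshev_U n)) (-1) = (-1) ^ (n + 1) * of_nat n * (of_nat n + 1) * (of_nat n + 2)"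
proof (induction n rule: chebyshev_U.induct)
  case (3 n)
  have "3 * poly (pderiv (chebyshev_U (Suc (Suc n)))) (-1) =
      - 2 * (3 * poly (pderiv (chebyshev_U (Suc n))) (-1)) - 3 * poly (pderiv (chebyshev_U n)) (-1)
        + 6 * (-1) ^ (n + 1) * (of_nat n + 2)"
    by (simp add: pderiv_diff pderiv_mult pderiv_smult pderiv_pCons poly_chebyshev_U_minus_1 algebra_simps)
  also have "\<dots> = (-1) ^ (Suc (Suc n) + 1) * of_nat (Suc (Suc n)) * (of_nat (Suc (Suc n)) + 1) * (of_nat (Suc (Suc n)) + 2)"
    unfolding 3 by (simp add: algebra_simps)
  finally show ?case .
qed (simp_all add: pderiv_pCons)

lemma chebyshev_U_expansion:
  fixes q :: "complex poly"
  assumes "degree q \<le> N"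
  shows "\<exists>a. q = (\<Sum>j\<le>N. smult (a j) (chebyshev_U j))"
  using assms
proof (induction N arbitrary: q)
  case 0
  then have "q = smult (coeff q 0) (chebyshev_U 0)"
    by (metis chebyshev_U.simps(1) degree_eq_zeroE le_zero_eq smult_one coeff_pCons_0)
  then show ?case by (intro exI[of _ "\<lambda>_. coeff q 0"]) simp
next
  case (Suc N)
  define c where "c = coeff q (Suc N) / 2 ^ Suc N"
  have "degree (q - smult c (chebyshev_U (Suc N))) \<le> N"
  proof (rule degree_le, intro allI impI)
    fix i assume "N < i"
    show "coeff (q - smult c (chebyshev_U (Suc N))) i = 0"
    proof (cases "i = Suc N")
      case True
      then show ?thesis by (simp add: coeff_chebyshev_U c_def del: power_Suc)
    next
      case False
      then have "coeff q i = 0" "coeff (chebyshev_U (Suc N)) i = 0"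
        using Suc.prems degree_chebyshev_U_le[of "Suc N"] \<open>N < i\<close> by (auto intro!: coeff_eq_0)
      then show ?thesis by simp
    qed
  qed
  from Suc.IH[OF this] obtain a where "q - smult c (chebyshev_U (Suc N)) = (\<Sum>j\<le>N. smult (a j) (chebyshev_U j))"
    by blast
  then have "q = (\<Sum>j\<le>Suc N. smult ((a(Suc N := c)) j) (chebyshev_U j))"
    by (simp add: algebra_simps)
  then show ?case by blast
qed

text \<open>
  In terms of \<open>\<theta> = arccos x\<close> the integrand is \<open>sin ((k + 1) \<theta>) sin ((l + 1) \<theta>) / sin \<theta>\<close>. The product
  of sines is half a difference of cosines, which yields an explicit antiderivative \<open>G\<close>
  that is continuous up to the end points.
\<close>

lemma chebyshev_U_orthogonal:
  "((\<lambda>x. complex_of_real (sqrt (1 - x\<^sup>2)) * (poly (chebyshev_U k) (of_real x) * poly (chebyshev_U l) (of_real x)))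
     has_integral (if k = l then of_real (pi / 2) else 0)) {-1<..<1}"
proof -
  define d where "d = real k - real l"
  define G where "G = (\<lambda>x. - (if k = l then arccos x else sin (d * arccos x) / d) / 2
      + sin (real (k + l + 2) * arccos x) / (2 * real (k + l + 2)))"
  have "((\<lambda>x. sin (real (k + 1) * arccos x) * sin (real (l + 1) * arccos x) / sqrt (1 - x\<^sup>2))
      has_integral (G 1 - G (-1))) {-1..1}"
  proof (rule fundamental_theorem_of_calculus_interior)
    show "continuous_on {-1..1} G"
      unfolding G_def by (cases "k = l") (auto intro!: continuous_intros simp: d_def)
    fix x :: real assume x: "x \<in> {-1<..<1}"
    let ?\<theta> = "arccos x"
    have pos: "1 - x\<^sup>2 > 0"
      using x by (simp add: abs_square_less_1 abs_less_iff)
    have s: "sqrt (1 - x\<^sup>2) > 0" using pos by simp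
    have arc: "(arccos has_real_derivative - 1 / sqrt (1 - x\<^sup>2)) (at x)"
      using DERIV_arccos[of x] x by (simp add: field_simps)
    have D: "((\<lambda>x. sin (c * arccos x)) has_real_derivative cos (c * ?\<theta>) * (c * (- 1 / sqrt (1 - x\<^sup>2)))) (at x)" for c
      by (rule DERIV_chain2[OF DERIV_sin DERIV_cmult[OF arc]])
    have diff: "((\<lambda>x. (if k = l then arccos x else sin (d * arccos x) / d)) has_real_derivative
        - (cos (d * ?\<theta>) / sqrt (1 - x\<^sup>2))) (at x)"
    proof (cases "k = l")
      case True
      then show ?thesis using arc by (simp add: d_def)
    next
      case False
      then have "d \<noteq> 0" by (simp add: d_def)
      then show ?thesis using DERIV_cdivide[OF D[of d], of d] False by simp
    qed
    have sum: "((\<lambda>x. sin (real (k + l + 2) * arccos x) / (2 * real (k + l + 2))) has_real_derivative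
        - (cos (real (k + l + 2) * ?\<theta>) / sqrt (1 - x\<^sup>2)) / 2) (at x)"
    proof -
      define m where "m = real (k + l + 2)"
      have "m > 0" by (simp add: m_def)
      then show ?thesis
        using DERIV_cdivide[OF D[of m], of "2 * m"] unfolding m_def[symmetric] by (simp add: mult_ac)
    qed
    have "(G has_real_derivative (cos (d * ?\<theta>) - cos (real (k + l + 2) * ?\<theta>)) / 2 / sqrt (1 - x\<^sup>2)) (at x)"
      unfolding G_def using DERIV_add[OF DERIV_cdivide[OF DERIV_minus[OF diff], of 2] sum]
      by (simp add: diff_divide_distrib mult.commute del: of_nat_add)
    also have "(cos (d * ?\<theta>) - cos (real (k + l + 2) * ?\<theta>)) / 2 =
        sin (real (k + 1) * ?\<theta>) * sin (real (l + 1) * ?\<theta>)"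
    proof -
      have "d * ?\<theta> = real (k + 1) * ?\<theta> - real (l + 1) * ?\<theta>"
        "real (k + l + 2) * ?\<theta> = real (k + 1) * ?\<theta> + real (l + 1) * ?\<theta>"
        by (simp_all add: d_def algebra_simps)
      then show ?thesis by (simp only: cos_add cos_diff) simp
    qed
    finally show "(G has_vector_derivative sin (real (k + 1) * ?\<theta>) * sin (real (l + 1) * ?\<theta>) / sqrt (1 - x\<^sup>2)) (at x)"
      by (simp add: has_real_derivative_iff_has_vector_derivative)
  qed simp
  also have "G 1 - G (-1) = (if k = l then pi / 2 else 0)"
  proof -
    have "sin (d * pi) = 0"
      by (simp add: d_def left_diff_distrib sin_diff)
    moreover have "sin (real (k + l + 2) * pi) = 0" by (rule sin_npi)
    ultimately show ?thesis by (auto simp: G_def simp del: of_nat_add)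
  qed
  finally have "((\<lambda>x. sin (real (k + 1) * arccos x) * sin (real (l + 1) * arccos x) / sqrt (1 - x\<^sup>2))
      has_integral (if k = l then pi / 2 else 0)) {-1<..<1}"
    by (simp add: has_integral_Icc_iff_Ioo)
  from has_integral_linear[OF this bounded_linear_of_real[where ?'a = complex]]
  have *: "((\<lambda>x. complex_of_real (sin (real (k + 1) * arccos x) * sin (real (l + 1) * arccos x) / sqrt (1 - x\<^sup>2)))
      has_integral (if k = l then of_real (pi / 2) else 0)) {-1<..<1}"
    by (cases "k = l") (simp_all add: o_def)
  show ?thesis
  proof (rule has_integral_eq[OF _ *])
    fix x :: real assume x: "x \<in> {-1<..<1}"
    then have "sqrt (1 - x\<^sup>2) > 0" by (simp add: abs_square_less_1 abs_less_iff)
    then show "complex_of_real (sin (real (k + 1) * arccos x) * sin (real (l + 1) * arccos x) / sqrt (1 - x\<^sup>2)) =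
      complex_of_real (sqrt (1 - x\<^sup>2)) * (poly (chebyshev_U k) (of_real x) * poly (chebyshev_U l) (of_real x))"
      unfolding of_real_divide of_real_mult chebyshev_U_arccos[OF x, symmetric] by (simp add: field_simps)
  qed
qed

text \<open>
  Expand \<open>q\<close> in \<open>U\<^sub>0, \<dots>, U\<^sub>n\<^sub>+\<^sub>2\<close>. For \<open>k < n\<close>, integrating \<open>q\<close> against \<open>U\<^sub>k\<close> gives \<open>\<pi>/2\<close> times the
  coefficient of \<open>U\<^sub>k\<close> and also \<open>0\<close>, since \<open>U\<^sub>k\<close> is a combination of powers below \<open>n\<close>.
\<close>

lemma chebyshev_U_expansion_of_orthogonal:
  fixes q :: "complex poly"
  assumes deg: "degree q \<le> n + 2"
    and orth: "\<And>k. k < n \<Longrightarrow>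
      ((\<lambda>x. complex_of_real (sqrt (1 - x\<^sup>2)) * (poly q (of_real x) * of_real x ^ k)) has_integral 0) {-1<..<1}"
  obtains a b c where "q = smult a (chebyshev_U n) + smult b (chebyshev_U (n + 1)) + smult c (chebyshev_U (n + 2))"
proof -
  let ?w = "\<lambda>x. complex_of_real (sqrt (1 - x\<^sup>2))"
  obtain a where a: "q = (\<Sum>j\<le>n + 2. smult (a j) (chebyshev_U j))"
    using chebyshev_U_expansion[OF deg] by blast
  have "a k = 0" if "k < n" for k
  proof -
    have "((\<lambda>x. \<Sum>i\<le>k. coeff (chebyshev_U k) i * (?w x * (poly q (of_real x) * of_real x ^ i))) has_integral
        (\<Sum>i\<le>k. coeff (chebyshev_U k) i * 0)) {-1<..<1}"
      by (intro has_integral_sum has_integral_mult_right orth) (use that in auto)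
    moreover have "(\<Sum>i\<le>k. coeff (chebyshev_U k) i * (?w x * (poly q (of_real x) * of_real x ^ i))) =
        ?w x * (poly q (of_real x) * poly (chebyshev_U k) (of_real x))" for x
    proof -
      have "poly (chebyshev_U k) (of_real x) = (\<Sum>i\<le>k. coeff (chebyshev_U k) i * of_real x ^ i)"
        unfolding poly_altdef using degree_chebyshev_U_le[of k]
        by (intro sum.mono_neutral_left) (auto intro!: coeff_eq_0)
      then show ?thesis by (simp add: sum_distrib_left mult_ac)
    qed
    ultimately have 1: "((\<lambda>x. ?w x * (poly q (of_real x) * poly (chebyshev_U k) (of_real x))) has_integral 0) {-1<..<1}"
      by simp
    have "((\<lambda>x. \<Sum>j\<le>n + 2. a j * (?w x * (poly (chebyshev_U j) (of_real x) * poly (chebyshev_U k) (of_real x)))) has_integral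
        (\<Sum>j\<le>n + 2. a j * (if j = k then of_real (pi / 2) else 0))) {-1<..<1}"
      by (intro has_integral_sum has_integral_mult_right chebyshev_U_orthogonal) simp
    moreover have "(\<Sum>j\<le>n + 2. a j * (?w x * (poly (chebyshev_U j) (of_real x) * poly (chebyshev_U k) (of_real x)))) =
        ?w x * (poly q (of_real x) * poly (chebyshev_U k) (of_real x))" for x
      unfolding a poly_sum sum_distrib_left sum_distrib_right by (intro sum.cong) simp_all
    moreover have "(\<Sum>j\<le>n + 2. a j * (if j = k then of_real (pi / 2) else 0)) = a k * of_real (pi / 2)"
      using that by (simp add: if_distrib cong: if_cong)
    ultimately have "((\<lambda>x. ?w x * (poly q (of_real x) * poly (chebyshev_U k) (of_real x))) has_integral a k * of_real (pi / 2)) {-1<..<1}"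
      by (simp only:)
    from has_integral_unique[OF 1 this] show ?thesis by simp
  qed
  then have "(\<Sum>j<n. smult (a j) (chebyshev_U j)) = 0" by simp
  moreover have "{..n + 2} = {..<n} \<union> {n, n + 1, n + 2}" by auto
  ultimately have "q = (\<Sum>j\<in>{n, n + 1, n + 2}. smult (a j) (chebyshev_U j))"
    unfolding a by (simp add: sum.union_disjoint)
  then show ?thesis using that[of "a n" "a (n + 1)" "a (n + 2)"] by (simp add: add.assoc)
qed

section \<open>Moments of matrix orthogonal polynomials\<close>

lemma matrix_mult_scaleR_left:
  fixes A :: "complex ^ 'n::finite ^ 'm" shows "(c *\<^sub>R A) ** B = c *\<^sub>R (A ** B)"
  by (simp add: matrix_matrix_mult_def vec_eq_iff scaleR_sum_right)

lemma matrix_mult_scaleR_right: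
  fixes A :: "complex ^ 'n::finite ^ 'm" shows "A ** (c *\<^sub>R B) = c *\<^sub>R (A ** B)"
  by (simp add: matrix_matrix_mult_def vec_eq_iff scaleR_sum_right)

lemma matrix_mult_sum_right:
  fixes A :: "complex ^ 'n::finite ^ 'm" shows "A ** (\<Sum>j\<in>J. B j) = (\<Sum>j\<in>J. A ** B j)"
  by (induction J rule: infinite_finite_induct) (simp_all add: matrix_add_ldistrib)

lemma bounded_linear_matrix_mult_right:
  "bounded_linear (\<lambda>A :: complex ^ 'n::finite ^ 'm::finite. A ** (B :: complex ^ 'k::finite ^ 'n))"
  unfolding linear_conv_bounded_linear[symmetric]
  by (rule linearI) (simp_all add: matrix_mult_scaleR_left, simp add: matrix_matrix_mult_def vec_eq_iff distrib_right sum.distrib)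

lemma conj_transpose_meval:
  assumes "monic_of_degree k Q"
  shows "conj_transpose (meval Q x) =
    x ^ k *\<^sub>R mat 1 + (\<Sum>j<k. x ^ j *\<^sub>R conj_transpose (mcoeff Q j))"
proof -
  have lead: "coeff (Q $ i $ j) k = (if i = j then 1 else 0)" for i j
    using assms by (auto simp: monic_of_degree_def mcoeff_def map_matrix_def vec_eq_iff mat_def)
  have deg: "degree (Q $ i $ j) \<le> k" for i j
    using assms by (intro degree_le) (auto simp: monic_of_degree_def mcoeff_def map_matrix_def vec_eq_iff)
  have "poly (Q $ i $ j) (of_real x) = of_real x ^ k * (if i = j then 1 else 0)
      + (\<Sum>l<k. of_real x ^ l * coeff (Q $ i $ j) l)" for i j
  proof -
    have "poly (Q $ i $ j) (of_real x) = (\<Sum>l\<le>k. coeff (Q $ i $ j) l * of_real x ^ l)"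
      unfolding poly_altdef using deg[of i j]
      by (intro sum.mono_neutral_left) (auto intro!: coeff_eq_0)
    then show ?thesis by (simp add: lessThan_Suc_atMost[symmetric] lead mult.commute)
  qed
  then show ?thesis
    by (simp add: vec_eq_iff conj_transpose_def meval_def mcoeff_def map_matrix_def transpose_def
        mat_def scaleR_conv_of_real[where ?'a = complex])
qed

text \<open>
  Since the \<open>P\<^sub>k\<close> are monic, \<open>x\<^sup>k\<close> times the identity is \<open>P\<^sub>k(x)\<^sup>*\<close> minus lower powers times constant
  matrices; these act from the right and so commute with the integral. Strong induction on \<open>k\<close>
  therefore turns orthogonality to the \<open>P\<^sub>k\<close> into vanishing of the moments, and at the same time
  supplies the integrability of each moment.
\<close>

lemma monic_MOPs_moments:
  fixes P :: "nat \<Rightarrow> 'n::finite mpoly"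
  assumes "monic_MOPs I W P" "k < n"
  shows "((\<lambda>x. x ^ k *\<^sub>R (meval (P n) x ** W x)) has_integral 0) I"
  using \<open>k < n\<close>
proof (induction k rule: less_induct)
  case (less k)
  let ?F = "\<lambda>x. meval (P n) x ** W x"
  have "((\<lambda>x. ?F x ** conj_transpose (meval (P k) x)
      - (\<Sum>j<k. (x ^ j *\<^sub>R ?F x) ** conj_transpose (mcoeff (P k) j))) has_integral
      0 - (\<Sum>j<k. 0 ** conj_transpose (mcoeff (P k) j))) I"
  proof (intro has_integral_diff has_integral_sum)
    show "((\<lambda>x. ?F x ** conj_transpose (meval (P k) x)) has_integral 0) I"
      using assms(1) less.prems by (auto simp: monic_MOPs_def)
    fix j assume "j \<in> {..<k}"
    then have "((\<lambda>x. x ^ j *\<^sub>R ?F x) has_integral 0) I" using less by simp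
    from has_integral_linear[OF this bounded_linear_matrix_mult_right]
    show "((\<lambda>x. (x ^ j *\<^sub>R ?F x) ** conj_transpose (mcoeff (P k) j)) has_integral
        0 ** conj_transpose (mcoeff (P k) j)) I" by (simp add: o_def)
  qed simp
  moreover have "monic_of_degree k (P k)" using assms(1) by (simp add: monic_MOPs_def)
  then have "?F x ** conj_transpose (meval (P k) x)
      - (\<Sum>j<k. (x ^ j *\<^sub>R ?F x) ** conj_transpose (mcoeff (P k) j)) = x ^ k *\<^sub>R ?F x" for x
    by (simp add: conj_transpose_meval matrix_add_ldistrib matrix_mult_scaleR_left
        matrix_mult_scaleR_right matrix_mult_sum_right)
  moreover have "0 ** B = (0 :: complex ^ 'n ^ 'n)" for B :: "complex ^ 'n ^ 'n"
    by (simp add: matrix_matrix_mult_def vec_eq_iff)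
  ultimately show ?case by simp
qed

section \<open>The boundary conditions at 1 and -1\<close>

text \<open>
  Here \<open>(s1, s2)\<close> is the row \<open>(p1, p2)\<close> times \<open>M1\<close>, with \<open>r\<close> in the role of \<open>sqrt 2\<close>, and \<open>e = \<plusminus>1\<close>. Both
  conditions come from \<open>M1 (1, - r x)\<^sup>T = (1 - x\<^sup>2) (2, r x)\<^sup>T\<close>: the polynomial \<open>s1 - r x s2\<close> equals
  \<open>(1 - x\<^sup>2) (2 p1 + r x p2)\<close>, so it vanishes at \<open>e\<close>, and its derivative there is
  \<open>- 2 e (2 p1 + r e p2)\<close>, a multiple of \<open>s2 (e)\<close> because \<open>M1\<close> has rank one at \<open>e\<close>.
\<close>

lemma M1_product_boundary:
  fixes p1 p2 s1 s2 :: "complex poly" and r e :: complex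
  assumes r: "r * r = 2" and e: "e * e = 1"
    and s1: "s1 = p1 * [:2, 0, 4:] + p2 * [:0, 3 * r:]"
    and s2: "s2 = p1 * [:0, 3 * r:] + p2 * [:2, 0, 1:]"
  shows "poly s1 e = r * e * poly s2 e"
    and "3 * poly (pderiv s1) e - r * e * (3 * poly (pderiv s2) e) = r * poly s2 e"
proof -
  define q1 q2 d1 d2 where "q1 = poly p1 e" and "q2 = poly p2 e"
    and "d1 = poly (pderiv p1) e" and "d2 = poly (pderiv p2) e"
  have v: "poly s1 e = 6 * q1 + 3 * r * e * q2" "poly s2 e = 3 * r * e * q1 + 3 * q2"
    using e unfolding s1 s2 q1_def q2_def by (simp_all add: algebra_simps)
  have d: "poly (pderiv s1) e = 6 * d1 + 8 * e * q1 + 3 * r * e * d2 + 3 * r * q2"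
    "poly (pderiv s2) e = 3 * r * e * d1 + 3 * r * q1 + 3 * d2 + 2 * e * q2"
  proof -
    have "poly (pderiv s1) e = d1 * (2 + 4 * (e * e)) + 8 * e * q1 + 3 * r * e * d2 + 3 * r * q2"
      "poly (pderiv s2) e = 3 * r * e * d1 + 3 * r * q1 + d2 * (2 + e * e) + 2 * e * q2"
      unfolding s1 s2 q1_def q2_def d1_def d2_def
      by (simp_all add: pderiv_add pderiv_mult pderiv_smult pderiv_pCons algebra_simps)
    then show "poly (pderiv s1) e = 6 * d1 + 8 * e * q1 + 3 * r * e * d2 + 3 * r * q2"
      "poly (pderiv s2) e = 3 * r * e * d1 + 3 * r * q1 + 3 * d2 + 2 * e * q2"
      unfolding e by simp_all
  qed
  show "poly s1 e = r * e * poly s2 e"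
  proof -
    have "r * e * (3 * r * e * q1 + 3 * q2) = 3 * (r * r) * (e * e) * q1 + 3 * r * e * q2"
      by (simp add: algebra_simps)
    then show ?thesis unfolding v r e by simp
  qed
  show "3 * poly (pderiv s1) e - r * e * (3 * poly (pderiv s2) e) = r * poly s2 e"
  proof -
    have "3 * (6 * d1 + 8 * e * q1 + 3 * r * e * d2 + 3 * r * q2)
        - r * e * (3 * (3 * r * e * d1 + 3 * r * q1 + 3 * d2 + 2 * e * q2)) =
      18 * d1 + 24 * e * q1 + 9 * r * q2 - 9 * (r * r) * (e * e) * d1 - 9 * (r * r) * e * q1
        - 6 * (e * e) * r * q2"
      by (simp add: algebra_simps)
    moreover have "r * (3 * r * e * q1 + 3 * q2) = 3 * (r * r) * e * q1 + 3 * r * q2"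
      by (simp add: algebra_simps)
    ultimately show ?thesis unfolding v d r e by simp
  qed
qed

text \<open>
  The boundary conditions at \<open>1\<close> and \<open>-1\<close> are four linear equations in \<open>a0, a1, b0, b1\<close>. As \<open>U\<^sub>k\<close> has
  the parity of \<open>k\<close>, sums and differences of the equations at the two points separate \<open>a0, b1\<close>
  (driven by \<open>a2\<close>) from \<open>a1, b0\<close> (driven by \<open>b2\<close>), and each half is solved by hand.
\<close>

lemma chebyshev_U_coefficients:
  fixes r :: complex
  assumes r: "r * r = 2"
    and s1: "s1 = p1 * [:2, 0, 4:] + p2 * [:0, 3 * r:]"
    and s2: "s2 = p1 * [:0, 3 * r:] + p2 * [:2, 0, 1:]"
    and a: "s1 = smult a0 (chebyshev_U n) + smult a1 (chebyshev_U (n + 1)) + smult a2 (chebyshev_U (n + 2))"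
    and b: "s2 = smult b0 (chebyshev_U n) + smult b1 (chebyshev_U (n + 1)) + smult b2 (chebyshev_U (n + 2))"
  shows "(of_nat n + 1) * a0 = (of_nat n + 3) * a2"
    and "(of_nat n + 1) * a1 = 2 * r * (of_nat n + 3) * b2"
    and "(of_nat n + 1)\<^sup>2 * b0 = (of_nat n + 3)\<^sup>2 * b2"
    and "(of_nat n + 2) * b1 = r * (of_nat n + 3) * a2"
proof -
  \<comment> \<open>With \<open>N = n + 2\<close> the three values \<open>U\<^sub>k(1)\<close> are \<open>N - 1, N, N + 1\<close>; this symmetry shortens the algebra.\<close>
  define N :: complex where "N = of_nat n + 2"
  define \<sigma> :: complex where "\<sigma> = (-1) ^ n"
  have \<sigma>: "\<sigma> \<noteq> 0" by (simp add: \<sigma>_def)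
  have nz: "N \<noteq> 0" "of_nat n = N - 2"
    using of_nat_neq_0[of "n + 1", where ?'a = complex] by (simp_all add: N_def add_ac)
  have v: "poly (smult c0 (chebyshev_U n) + smult c1 (chebyshev_U (n + 1)) + smult c2 (chebyshev_U (n + 2))) 1 =
      c0 * (N - 1) + c1 * N + c2 * (N + 1)"
    "poly (smult c0 (chebyshev_U n) + smult c1 (chebyshev_U (n + 1)) + smult c2 (chebyshev_U (n + 2))) (-1) =
      \<sigma> * (c0 * (N - 1) - c1 * N + c2 * (N + 1))" for c0 c1 c2
    unfolding poly_add poly_smult poly_chebyshev_U_1 poly_chebyshev_U_minus_1
    by (simp_all add: N_def \<sigma>_def algebra_simps)
  have d: "3 * poly (pderiv (smult c0 (chebyshev_U n) + smult c1 (chebyshev_U (n + 1)) + smult c2 (chebyshev_U (n + 2)))) 1 =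
      c0 * ((N - 2) * (N - 1) * N) + c1 * ((N - 1) * N * (N + 1)) + c2 * (N * (N + 1) * (N + 2))" (is ?A)
    "3 * poly (pderiv (smult c0 (chebyshev_U n) + smult c1 (chebyshev_U (n + 1)) + smult c2 (chebyshev_U (n + 2)))) (-1) =
      - \<sigma> * (c0 * ((N - 2) * (N - 1) * N) - c1 * ((N - 1) * N * (N + 1)) + c2 * (N * (N + 1) * (N + 2)))" (is ?B)
    for c0 c1 c2
  proof -
    have "3 * poly (pderiv (smult c0 (chebyshev_U n) + smult c1 (chebyshev_U (n + 1)) + smult c2 (chebyshev_U (n + 2)))) z =
      c0 * (3 * poly (pderiv (chebyshev_U n)) z) + c1 * (3 * poly (pderiv (chebyshev_U (n + 1))) z)
       + c2 * (3 * poly (pderiv (chebyshev_U (n + 2))) z)" for z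
      by (simp add: pderiv_add pderiv_smult algebra_simps del: chebyshev_U.simps)
    note * = this
    show ?A ?B
      unfolding * poly_pderiv_chebyshev_U_1 poly_pderiv_chebyshev_U_minus_1
      by (simp_all add: N_def \<sigma>_def algebra_simps)
  qed
  note b1 = M1_product_boundary[OF r _ s1 s2, of 1, simplified, unfolded a b v d]
  note b2 = M1_product_boundary[OF r _ s1 s2, of "-1", simplified, unfolded a b v d]
  have e1: "a0 * (N - 1) + a1 * N + a2 * (N + 1) = r * (b0 * (N - 1) + b1 * N + b2 * (N + 1))"
    using b1(1) .
  have "\<sigma> * (a0 * (N - 1) - a1 * N + a2 * (N + 1)) = \<sigma> * - (r * (b0 * (N - 1) - b1 * N + b2 * (N + 1)))"
    using b2(1) by (simp add: algebra_simps)
  then have e2: "a0 * (N - 1) - a1 * N + a2 * (N + 1) = - (r * (b0 * (N - 1) - b1 * N + b2 * (N + 1)))"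
    using \<sigma> by (subst (asm) mult_cancel_left) simp
  \<comment> \<open>The contributions to three times the derivative at \<open>1\<close> of \<open>U\<^sub>n, U\<^sub>n\<^sub>+\<^sub>2\<close> (in \<open>A\<close>) and of \<open>U\<^sub>n\<^sub>+\<^sub>1\<close> (in \<open>B\<close>).\<close>
  define A where "A = (\<lambda>c0 c2. c0 * ((N - 2) * (N - 1) * N) + c2 * (N * (N + 1) * (N + 2)))"
  define B where "B = (\<lambda>c1. c1 * ((N - 1) * N * (N + 1)))"
  have e3: "A a0 a2 + B a1 - r * (A b0 b2 + B b1) = r * (b0 * (N - 1) + b1 * N + b2 * (N + 1))"
    using b1(2) unfolding A_def B_def by (simp add: algebra_simps)
  have "\<sigma> * (- (A a0 a2 - B a1) - r * (A b0 b2 - B b1)) = \<sigma> * (r * (b0 * (N - 1) - b1 * N + b2 * (N + 1)))"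
    using b2(2) unfolding A_def B_def by (simp add: algebra_simps)
  then have e4: "- (A a0 a2 - B a1) - r * (A b0 b2 - B b1) = r * (b0 * (N - 1) - b1 * N + b2 * (N + 1))"
    using \<sigma> by (subst (asm) mult_cancel_left) simp
  \<comment> \<open>Half sums and half differences of the equations at \<open>1\<close> and \<open>-1\<close>.\<close>
  have f1: "a0 * (N - 1) + a2 * (N + 1) = r * b1 * N" using e1 e2 by algebra
  have f2: "a1 * N = r * (b0 * (N - 1) + b2 * (N + 1))" using e1 e2 by algebra
  have f3: "A a0 a2 - r * B b1 = r * b1 * N" using e3 e4 by algebra
  have f4: "B a1 - r * A b0 b2 = r * (b0 * (N - 1) + b2 * (N + 1))" using e3 e4 by algebra
  have "(2 * N) * ((N - 1) * a0) = (2 * N) * ((N + 1) * a2)"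
    using f1 f3 unfolding A_def B_def by algebra
  then have g1: "(N - 1) * a0 = (N + 1) * a2" using nz by simp
  have "(2 * r) * ((N - 1)\<^sup>2 * b0) = (2 * r) * ((N + 1)\<^sup>2 * b2)"
    using f2 f4 unfolding A_def B_def by algebra
  moreover have "r \<noteq> 0" using r by auto
  ultimately have g2: "(N - 1)\<^sup>2 * b0 = (N + 1)\<^sup>2 * b2" by simp
  have "(r * 1) * (N * b1) = r * (r * (N + 1) * a2)" using f1 g1 r by algebra
  then have g3: "N * b1 = r * (N + 1) * a2" using \<open>r \<noteq> 0\<close> by simp
  have "N * ((N - 1) * a1) = N * (2 * r * (N + 1) * b2)" using f2 g2 by algebra
  then have g4: "(N - 1) * a1 = 2 * r * (N + 1) * b2" using nz by simp
  have N: "of_nat n + 1 = N - 1" "of_nat n + 2 = N" "of_nat n + 3 = N + 1" by (simp_all add: N_def)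
  show "(of_nat n + 1) * a0 = (of_nat n + 3) * a2"
    "(of_nat n + 1) * a1 = 2 * r * (of_nat n + 3) * b2"
    "(of_nat n + 1)\<^sup>2 * b0 = (of_nat n + 3)\<^sup>2 * b2"
    "(of_nat n + 2) * b1 = r * (of_nat n + 3) * a2"
    unfolding N using g1 g2 g3 g4 by blast+
qed

section \<open>The orthogonal polynomials in terms of Chebyshev polynomials\<close>

lemma cmat2_nth [simp]:
  "cmat2 a b c d $ 1 $ 1 = of_real a" "cmat2 a b c d $ 1 $ 2 = of_real b"
  "cmat2 a b c d $ 2 $ 1 = of_real c" "cmat2 a b c d $ 2 $ 2 = of_real d"
  by (simp_all add: cmat2_def map_matrix_def)

lemma cmat2_eq_iff:
  "A = cmat2 a b c d \<longleftrightarrow>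
    A $ 1 $ 1 = of_real a \<and> A $ 1 $ 2 = of_real b \<and> A $ 2 $ 1 = of_real c \<and> A $ 2 $ 2 = of_real d"
  by (simp add: vec_eq_iff forall_2)

text \<open>
  The explicit form of \<open>P\<^sub>n W1\<close>. Each row of \<open>P\<^sub>n M1\<close> is a combination of three Chebyshev polynomials
  with coefficients governed by those of \<open>U\<^sub>n\<^sub>+\<^sub>2\<close>. The leading coefficient of \<open>P\<^sub>n M1\<close> is
  \<open>diag (4, 1)\<close> and that of \<open>U\<^sub>n\<^sub>+\<^sub>2\<close> is \<open>2\<^bsup>n+2\<^esup>\<close>, so these are \<open>4 / 2\<^bsup>n+2\<^esup>\<close> and \<open>1 / 2\<^bsup>n+2\<^esup>\<close> on the
  diagonal and \<open>0\<close> off it.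
\<close>

lemma monic_MOPs_W1_chebyshev:
  assumes P: "monic_MOPs {-1<..<1} W1 P" and x: "x \<in> {-1<..<1}"
  shows "meval (P n) x ** W1 x =
    (1 / 2 ^ (n + 2)) *\<^sub>R
      cmat2 (4 * ((real n + 3) / (real n + 1) * sin (real (n + 1) * arccos x) + sin (real (n + 3) * arccos x)))
        (4 * sqrt 2 * (real n + 3) / (real n + 2) * sin (real (n + 2) * arccos x))
        (2 * sqrt 2 * (real n + 3) / (real n + 1) * sin (real (n + 2) * arccos x))
        (((real n + 3) / (real n + 1))\<^sup>2 * sin (real (n + 1) * arccos x) + sin (real (n + 3) * arccos x))"
proof -
  define r where "r = complex_of_real (sqrt 2)"
  have r: "r * r = 2" by (simp add: r_def flip: of_real_mult)
  let ?w = "\<lambda>x. complex_of_real (sqrt (1 - x\<^sup>2))"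
  let ?S = "\<lambda>k. complex_of_real (sin (real (n + k) * arccos x))"
  have monic: "monic_of_degree n (P n)" using P by (simp add: monic_MOPs_def)
  have lead: "coeff (P n $ i $ j) n = (if i = j then 1 else 0)" for i j
    using monic by (auto simp: monic_of_degree_def mcoeff_def map_matrix_def vec_eq_iff mat_def)
  have deg: "degree (P n $ i $ j) \<le> n" for i j
    using monic by (intro degree_le) (auto simp: monic_of_degree_def mcoeff_def map_matrix_def vec_eq_iff)
  define s1 where "s1 = (\<lambda>i. P n $ i $ 1 * [:2, 0, 4:] + P n $ i $ 2 * [:0, 3 * r:])"
  define s2 where "s2 = (\<lambda>i. P n $ i $ 1 * [:0, 3 * r:] + P n $ i $ 2 * [:2, 0, 1:])"
  have PW: "(meval (P n) t ** W1 t) $ i $ 1 = ?w t * poly (s1 i) (of_real t)"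
    "(meval (P n) t ** W1 t) $ i $ 2 = ?w t * poly (s2 i) (of_real t)" if "t \<in> {-1<..<1}" for t i
  proof -
    have "0 \<le> 1 - t\<^sup>2" using that by (simp add: abs_square_le_1 abs_le_iff)
    then show "(meval (P n) t ** W1 t) $ i $ 1 = ?w t * poly (s1 i) (of_real t)"
      "(meval (P n) t ** W1 t) $ i $ 2 = ?w t * poly (s2 i) (of_real t)"
      by (simp_all add: matrix_matrix_mult_def sum_2 W1_def M1_def meval_def map_matrix_def s1_def s2_def
          r_def powr_half_sqrt scaleR_conv_of_real[where ?'a = complex] power2_eq_square algebra_simps)
  qed
  have orth: "((\<lambda>x. ?w x * (poly (s i) (of_real x) * of_real x ^ k)) has_integral 0) {-1<..<1}"
    if "k < n" and s: "s = s1 \<and> j = 1 \<or> s = s2 \<and> j = 2" for i k s and j :: 2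
  proof -
    have "bounded_linear (\<lambda>A :: complex ^ 2 ^ 2. A $ i $ j)"
      by (intro bounded_linear_compose[OF bounded_linear_vec_nth] bounded_linear_vec_nth)
    from has_integral_linear[OF monic_MOPs_moments[OF P \<open>k < n\<close>] this]
    have "((\<lambda>x. (x ^ k *\<^sub>R (meval (P n) x ** W1 x)) $ i $ j) has_integral 0) {-1<..<1}"
      by (simp add: o_def)
    then show ?thesis
      by (rule has_integral_eq[rotated])
        (use s PW in \<open>auto simp: scaleR_conv_of_real[where ?'a = complex] mult_ac\<close>)
  qed
  have orth1: "((\<lambda>x. ?w x * (poly (s1 i) (of_real x) * of_real x ^ k)) has_integral 0) {-1<..<1}"
    and orth2: "((\<lambda>x. ?w x * (poly (s2 i) (of_real x) * of_real x ^ k)) has_integral 0) {-1<..<1}"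
    if "k < n" for i k
    using orth[where i = i and k = k and s = s1 and j = 1] orth[where i = i and k = k and s = s2 and j = 2] that
    by simp_all
  have coeff_mult: "coeff (q * [:c0, c1, c2:]) (n + 2) = c2 * coeff q n" if "degree q \<le> n" for q :: "complex poly" and c0 c1 c2
    using that by (simp add: coeff_eq_0 numeral_2_eq_2)
  have deg_mult: "degree (q * [:c0, c1, c2:]) \<le> n + 2" if "degree q \<le> n" for q :: "complex poly" and c0 c1 c2
  proof -
    have "degree [:c0, c1, c2:] \<le> 2" by simp
    then show ?thesis using degree_mult_le[of q "[:c0, c1, c2:]"] that by linarith
  qed
  \<comment> \<open>Lets the facts about quadratic factors apply to the off-diagonal entries of \<open>M1\<close>.\<close>
  have linear: "[:0, 3 * r:] = [:0, 3 * r, 0:]" by simp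
  have deg_s: "degree (s1 i) \<le> n + 2" "degree (s2 i) \<le> n + 2" for i
    unfolding s1_def s2_def linear by (intro degree_add_le deg_mult deg)+
  have lead_s: "coeff (s1 i) (n + 2) = (if i = 1 then 4 else 0)"
    "coeff (s2 i) (n + 2) = (if i = 2 then 1 else 0)" for i
    unfolding s1_def s2_def linear coeff_add coeff_mult[OF deg] lead using exhaust_2[of i] by auto
  have row: "\<exists>a0 a1 a2 b0 b1 b2.
      (meval (P n) x ** W1 x) $ i $ 1 = a0 * ?S 1 + a1 * ?S 2 + a2 * ?S 3 \<and>
      (meval (P n) x ** W1 x) $ i $ 2 = b0 * ?S 1 + b1 * ?S 2 + b2 * ?S 3 \<and>
      2 ^ (n + 2) * a2 = (if i = 1 then 4 else 0) \<and> 2 ^ (n + 2) * b2 = (if i = 2 then 1 else 0) \<and>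
      (of_nat n + 1) * a0 = (of_nat n + 3) * a2 \<and> (of_nat n + 1) * a1 = 2 * r * (of_nat n + 3) * b2 \<and>
      (of_nat n + 1)\<^sup>2 * b0 = (of_nat n + 3)\<^sup>2 * b2 \<and> (of_nat n + 2) * b1 = r * (of_nat n + 3) * a2" for i
  proof -
    obtain a0 a1 a2 where a: "s1 i = smult a0 (chebyshev_U n) + smult a1 (chebyshev_U (n + 1)) + smult a2 (chebyshev_U (n + 2))"
      by (rule chebyshev_U_expansion_of_orthogonal[OF deg_s(1)[of i] orth1[of _ i]])
    obtain b0 b1 b2 where b: "s2 i = smult b0 (chebyshev_U n) + smult b1 (chebyshev_U (n + 1)) + smult b2 (chebyshev_U (n + 2))"
      by (rule chebyshev_U_expansion_of_orthogonal[OF deg_s(2)[of i] orth2[of _ i]])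
    have val: "?w x * poly (smult c0 (chebyshev_U n) + smult c1 (chebyshev_U (n + 1)) + smult c2 (chebyshev_U (n + 2))) (of_real x) =
        c0 * ?S 1 + c1 * ?S 2 + c2 * ?S 3" for c0 c1 c2
    proof -
      have "?w x * poly (smult c0 (chebyshev_U n) + smult c1 (chebyshev_U (n + 1)) + smult c2 (chebyshev_U (n + 2))) (of_real x) =
        c0 * (?w x * poly (chebyshev_U n) (of_real x)) + c1 * (?w x * poly (chebyshev_U (n + 1)) (of_real x))
          + c2 * (?w x * poly (chebyshev_U (n + 2)) (of_real x))"
        unfolding poly_add poly_smult by (simp add: algebra_simps del: chebyshev_U.simps)
      then show ?thesis unfolding chebyshev_U_arccos[OF x] by (simp add: add.commute add.left_commute)
    qed
    have top: "coeff (smult c0 (chebyshev_U n) + smult c1 (chebyshev_U (n + 1)) + smult c2 (chebyshev_U (n + 2))) (n + 2) =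
        2 ^ (n + 2) * c2" for c0 c1 c2
      using degree_chebyshev_U_le[of n] degree_chebyshev_U_le[of "n + 1"]
      unfolding coeff_add coeff_smult coeff_chebyshev_U by (simp add: coeff_eq_0 del: chebyshev_U.simps)
    note coeffs = chebyshev_U_coefficients[OF r s1_def[THEN fun_cong, of i] s2_def[THEN fun_cong, of i] a b]
    show ?thesis
      using PW[OF x, of i, unfolded a b val] lead_s[of i, unfolded a b top] coeffs by blast
  qed
  have nz: "(of_nat n + 1 :: complex) \<noteq> 0" "(of_nat n + 2 :: complex) \<noteq> 0" "(2 ^ (n + 2) :: complex) \<noteq> 0"
    using of_nat_neq_0[of n, where ?'a = complex] of_nat_neq_0[of "n + 1", where ?'a = complex]
    by (simp_all add: add_ac)
  define \<kappa> where "\<kappa> = 1 / (2 :: complex) ^ (n + 2)"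
  obtain a0 a1 a2 b0 b1 b2 where row1:
      "(meval (P n) x ** W1 x) $ 1 $ 1 = a0 * ?S 1 + a1 * ?S 2 + a2 * ?S 3"
      "(meval (P n) x ** W1 x) $ 1 $ 2 = b0 * ?S 1 + b1 * ?S 2 + b2 * ?S 3"
    and eqs: "2 ^ (n + 2) * a2 = (if (1::2) = 1 then 4 else 0)" "2 ^ (n + 2) * b2 = (if (1::2) = 2 then 1 else 0)"
      "(of_nat n + 1) * a0 = (of_nat n + 3) * a2" "(of_nat n + 1) * a1 = 2 * r * (of_nat n + 3) * b2"
      "(of_nat n + 1)\<^sup>2 * b0 = (of_nat n + 3)\<^sup>2 * b2" "(of_nat n + 2) * b1 = r * (of_nat n + 3) * a2"
    using row[of 1] by blast
  have "a2 = 4 * \<kappa>" "b2 = 0" using eqs(1,2) nz by (simp_all add: \<kappa>_def field_simps)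
  moreover have "a0 = (of_nat n + 3) * a2 / (of_nat n + 1)" "b1 = r * (of_nat n + 3) * a2 / (of_nat n + 2)"
    using eqs(3,6) nz by (simp_all add: \<kappa>_def field_simps)
  ultimately have 1: "a2 = 4 * \<kappa>" "b2 = 0" "a1 = 0" "b0 = 0"
      "a0 = (of_nat n + 3) * (4 * \<kappa>) / (of_nat n + 1)"
      "b1 = r * (of_nat n + 3) * (4 * \<kappa>) / (of_nat n + 2)"
    using eqs(4,5) nz by simp_all
  obtain c0 c1 c2 d0 d1 d2 where row2:
      "(meval (P n) x ** W1 x) $ 2 $ 1 = c0 * ?S 1 + c1 * ?S 2 + c2 * ?S 3"
      "(meval (P n) x ** W1 x) $ 2 $ 2 = d0 * ?S 1 + d1 * ?S 2 + d2 * ?S 3"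
    and eqs: "2 ^ (n + 2) * c2 = (if (2::2) = 1 then 4 else 0)" "2 ^ (n + 2) * d2 = (if (2::2) = 2 then 1 else 0)"
      "(of_nat n + 1) * c0 = (of_nat n + 3) * c2" "(of_nat n + 1) * c1 = 2 * r * (of_nat n + 3) * d2"
      "(of_nat n + 1)\<^sup>2 * d0 = (of_nat n + 3)\<^sup>2 * d2" "(of_nat n + 2) * d1 = r * (of_nat n + 3) * c2"
    using row[of 2] by blast
  have "c2 = 0" "d2 = \<kappa>" using eqs(1,2) nz by (simp_all add: \<kappa>_def field_simps)
  moreover have "c1 = 2 * r * (of_nat n + 3) * d2 / (of_nat n + 1)"
    "d0 = (of_nat n + 3)\<^sup>2 * d2 / (of_nat n + 1)\<^sup>2"
    using eqs(4,5) nz by (simp_all add: \<kappa>_def field_simps)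
  ultimately have 2: "c2 = 0" "d2 = \<kappa>" "c0 = 0" "d1 = 0"
      "c1 = 2 * r * (of_nat n + 3) * \<kappa> / (of_nat n + 1)"
      "d0 = (of_nat n + 3)\<^sup>2 * \<kappa> / (of_nat n + 1)\<^sup>2"
    using eqs(3,6) nz by simp_all
  have entry: "(c *\<^sub>R A) $ i $ j = of_real c * A $ i $ j" for c and A :: "complex ^ 2 ^ 2" and i j
    by (simp add: scaleR_conv_of_real[where ?'a = complex])
  have \<kappa>: "of_real (1 / 2 ^ (n + 2)) = \<kappa>" by (simp add: \<kappa>_def)
  show ?thesis
    unfolding vec_eq_iff forall_2 entry \<kappa> cmat2_nth row1 row2 1 2 r_def
    by (simp add: distrib_left mult_ac power_divide) (simp add: algebra_simps)
qed

section \<open>The Rodrigues formula\<close>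

text \<open>
  The constant of the theorem is the one that makes its product with the classical Rodrigues
  constant rational: the Gamma factors and the signs cancel.
\<close>

lemma rodrigues_normalization:
  "(-1) ^ n * 2 powi (- 2 * int n - 2) * (real n + 2) * (real n + 3) * sqrt pi
       / ((2 * real n + 3) * Gamma (real n + 3/2)) * rodrigues_const n =
   1 / 2 ^ (n + 2) * (2 * (real n + 2) * (real n + 3) / ((real n + 1) * (2 * real n + 3)))"
proof -
  define G where "G = Gamma (real n + 3/2)"
  have "G > 0" unfolding G_def by (rule Gamma_real_pos) simp
  have "- 2 * int n - 2 = - int (2 * n + 2)" by simp
  then have "(2::real) powi (- 2 * int n - 2) = inverse (2 ^ (2 * n + 2))"
    by (simp only: power_int_minus power_int_of_nat)
  also have "2 * n + 2 = (n + 1) + (n + 1)" by simp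
  finally have p: "(2::real) powi (- 2 * int n - 2) = 1 / (2 ^ (n + 1) * 2 ^ (n + 1))"
    by (simp only: power_add divide_inverse mult_1)
  have s: "((-1) ^ n :: real) * (-1) ^ n = 1" by (simp add: power_mult_distrib[symmetric])
  have "u * (1 / (q * q)) * a * b * y / (d * G) * (u * q * G / (y * e)) = (u * u) * (1 / q * (a * b / (e * d)))"
    if "q > 0" "y > 0" "d > 0" "e > 0" for u q a b y d e :: real
    using that \<open>G > 0\<close> by (simp add: field_simps)
  from this[of "2 ^ (n + 1)" "sqrt pi" "2 * real n + 3" "real n + 1" "(-1) ^ n" "real n + 2" "real n + 3"]
  have "(-1) ^ n * (1 / (2 ^ (n + 1) * 2 ^ (n + 1))) * (real n + 2) * (real n + 3) * sqrt pi
       / ((2 * real n + 3) * G) * ((-1) ^ n * 2 ^ (n + 1) * G / (sqrt pi * (real n + 1))) =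
     ((-1) ^ n * (-1) ^ n) * (1 / 2 ^ (n + 1) * ((real n + 2) * (real n + 3) / ((real n + 1) * (2 * real n + 3))))"
    by simp
  moreover have "1 / 2 ^ (n + 2) * (2 * a * b / d) = 1 / 2 ^ (n + 1) * (a * b / d)" for a b d :: real
    by simp
  ultimately show ?thesis
    unfolding p rodrigues_const_def G_def[symmetric] s by (simp only: mult_1)
qed

text \<open>
  Sorting \<open>M1 t\<close> plus the correction matrix by powers of \<open>t\<close> leaves three scalar functions whose derivatives
  are known, each times a constant matrix.
\<close>

lemma nth_derivative_rodrigues_M1:
  assumes x: "x \<in> {-1<..<1}"
  shows "nth_derivative n
       (\<lambda>t. ((1 - t\<^sup>2) powr (1/2 + real n)) *\<^sub>R (M1 t + cmat2 \<alpha> (\<beta> * t) (\<gamma> * t) \<delta>)) x =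
    power_deriv (1/2 + real n) n x *\<^sub>R cmat2 (2 + \<alpha>) 0 0 (2 + \<delta>)
    + times_id (power_deriv (1/2 + real n)) n x *\<^sub>R cmat2 0 (3 * sqrt 2 + \<beta>) (3 * sqrt 2 + \<gamma>) 0
    + times_id (times_id (power_deriv (1/2 + real n))) n x *\<^sub>R cmat2 4 0 0 1"
proof -
  define D where "D = power_deriv (1/2 + real n)"
  define h where "h = (\<lambda>k t. D k t *\<^sub>R cmat2 (2 + \<alpha>) 0 0 (2 + \<delta>)
    + times_id D k t *\<^sub>R cmat2 0 (3 * sqrt 2 + \<beta>) (3 * sqrt 2 + \<gamma>) 0
    + times_id (times_id D) k t *\<^sub>R cmat2 4 0 0 1)"
  have D: "derivative_sequence {-1<..<1} D"
    unfolding D_def by (rule derivative_sequence_power_deriv)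
  have *: "(g has_vector_derivative g') (at t) \<Longrightarrow>
      ((\<lambda>t. g t *\<^sub>R A) has_vector_derivative g' *\<^sub>R A) (at t)"
    for g :: "real \<Rightarrow> real" and g' t and A :: "complex ^ 2 ^ 2"
    by (rule bounded_linear.has_vector_derivative[OF bounded_linear_scaleR_left])
  have "derivative_sequence {-1<..<1} h"
    using D derivative_sequence_times_id[OF D]
      derivative_sequence_times_id[OF derivative_sequence_times_id[OF D]]
    unfolding derivative_sequence_def h_def by (auto intro!: has_vector_derivative_add *)
  moreover have "((1 - t\<^sup>2) powr (1/2 + real n)) *\<^sub>R (M1 t + cmat2 \<alpha> (\<beta> * t) (\<gamma> * t) \<delta>) = h 0 t" for t
    by (simp add: h_def D_def times_id_def M1_def vec_eq_iff forall_2 algebra_simps power2_eq_square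
        scaleR_conv_of_real[where ?'a = complex])
  ultimately show ?thesis
    using nth_derivative_eq_derivative_sequence[of "{-1<..<1}" h _ x n] x
    unfolding h_def D_def by simp
qed

lemma invertible_W1:
  assumes "x \<in> {-1<..<1}"
  shows "invertible (W1 x)"
proof -
  have pos: "1 - x\<^sup>2 > 0"
    using assms by (simp add: abs_square_less_1 abs_less_iff)
  have "det (W1 x) = of_real (4 * (1 - x\<^sup>2) * (1 - x\<^sup>2) * (1 - x\<^sup>2))"
  proof -
    define w where "w = (1 - x\<^sup>2) powr (1/2)"
    have w: "w * w = 1 - x\<^sup>2" using pos by (simp add: w_def powr_half_sqrt)
    have "complex_of_real (sqrt 2) * complex_of_real (sqrt 2) = 2"
      by (simp flip: of_real_mult)
    then have "det (W1 x) = of_real ((w * w) * ((4 * x\<^sup>2 + 2) * (x\<^sup>2 + 2) - 9 * (sqrt 2 * sqrt 2) * x\<^sup>2))"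
      unfolding det_2 W1_def M1_def w_def[symmetric]
      by (simp add: scaleR_conv_of_real[where ?'a = complex] algebra_simps power2_eq_square)
    then show ?thesis unfolding w by (simp add: algebra_simps power2_eq_square)
  qed
  then show ?thesis using pos by (simp add: invertible_det_nz del: of_real_mult)
qed

theorem proposition8p2:
  fixes P :: "nat \<Rightarrow> 2 mpoly" and n :: nat and x :: real
  assumes "monic_MOPs {-1<..<1} W1 P"
    and "x \<in> {-1<..<1}"
  shows "meval (P n) x =
    ((-1) ^ n * 2 powi (- 2 * int n - 2) * (real n + 2) * (real n + 3) * sqrt pi
       / ((2 * real n + 3) * Gamma (real n + 3/2))) *\<^sub>R
    (nth_derivative n
       (\<lambda>t. ((1 - t\<^sup>2) powr (1/2 + real n)) *\<^sub>R
          (M1 t + cmat2 (2 * real n / (real n + 2)) (sqrt 2 * real n * t / (real n + 2))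
                        (- (sqrt 2 * real n * t / (real n + 1))) (- (real n / (real n + 1))))) x
     ** matrix_inv (W1 x))"
proof -
  define F where "F = nth_derivative n
       (\<lambda>t. ((1 - t\<^sup>2) powr (1/2 + real n)) *\<^sub>R
          (M1 t + cmat2 (2 * real n / (real n + 2)) (sqrt 2 * real n * t / (real n + 2))
                        (- (sqrt 2 * real n * t / (real n + 1))) (- (real n / (real n + 1))))) x"
  define c where "c = (-1) ^ n * 2 powi (- 2 * int n - 2) * (real n + 2) * (real n + 3) * sqrt pi
       / ((2 * real n + 3) * Gamma (real n + 3/2))"
  let ?D = "power_deriv (1/2 + real n)"
  let ?S = "\<lambda>k. sin (real (n + k) * arccos x)"
  define \<kappa> where "\<kappa> = 1 / (2::real) ^ (n + 2)"
  define N where "N = real n"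
  have N: "N \<ge> 0" by (simp add: N_def)
  have F: "F = ?D n x *\<^sub>R cmat2 (2 + 2 * N / (N + 2)) 0 0 (2 - N / (N + 1))
    + times_id ?D n x *\<^sub>R cmat2 0 (3 * sqrt 2 + sqrt 2 * N / (N + 2)) (3 * sqrt 2 - sqrt 2 * N / (N + 1)) 0
    + times_id (times_id ?D) n x *\<^sub>R cmat2 4 0 0 1"
    using nth_derivative_rodrigues_M1[OF assms(2), of n "2 * N / (N + 2)" "sqrt 2 * N / (N + 2)"
        "- (sqrt 2 * N / (N + 1))" "- (N / (N + 1))"]
    by (simp add: F_def N_def)
  define E T X where "E = c * ?D n x" and "T = c * times_id ?D n x" and "X = c * times_id (times_id ?D) n x"
  define g where "g = c * rodrigues_const n"
  have g: "g = \<kappa> * (2 * (N + 2) * (N + 3) / ((N + 1) * (2 * N + 3)))"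
    using rodrigues_normalization[of n] by (simp add: g_def c_def \<kappa>_def N_def)
  have E: "E = g * ?S 1"
    using rodrigues_chebyshev[OF assms(2), of n] by (simp add: E_def g_def)
  have "(N + 2) * T = c * ((N + 2) * times_id ?D n x)" by (simp add: T_def)
  also have "\<dots> = (N + 1) * g * ?S 2"
    using rodrigues_times_id[OF assms(2), of n] by (simp add: N_def g_def)
  finally have T: "T = (N + 1) / (N + 2) * g * ?S 2" using N by (simp add: field_simps)
  have "2 * (N + 2) * (N + 3) * X = c * (2 * (N + 2) * (N + 3) * times_id (times_id ?D) n x)" by (simp add: X_def)
  also have "\<dots> = g * ((N + 3) * ?S 1 + (N + 1) * (2 * N + 3) * ?S 3)"
    using rodrigues_times_id_times_id[OF assms(2), of n] by (simp add: N_def g_def)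
  finally have "2 * (N + 2) * (N + 3) * X = g * ((N + 3) * ?S 1 + (N + 1) * (2 * N + 3) * ?S 3)" .
  moreover have "2 * (N + 2) * (N + 3) \<noteq> 0" using N by simp
  ultimately have X: "X = g * ((N + 3) * ?S 1 + (N + 1) * (2 * N + 3) * ?S 3) / (2 * (N + 2) * (N + 3))"
    by (metis nonzero_mult_div_cancel_left)
  have entries:
    "E * (2 + 2 * N / (N + 2)) + X * 4 = \<kappa> * (4 * ((N + 3) / (N + 1) * ?S 1 + ?S 3))"
    "T * (3 * sqrt 2 + sqrt 2 * N / (N + 2)) = \<kappa> * (4 * sqrt 2 * (N + 3) / (N + 2) * ?S 2)"
    "T * (3 * sqrt 2 - sqrt 2 * N / (N + 1)) = \<kappa> * (2 * sqrt 2 * (N + 3) / (N + 1) * ?S 2)"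
    "E * (2 - N / (N + 1)) + X = \<kappa> * (((N + 3) / (N + 1))\<^sup>2 * ?S 1 + ?S 3)"
  proof -
    define s where "s = sqrt 2"
    define S1 S2 S3 where "S1 = ?S 1" and "S2 = ?S 2" and "S3 = ?S 3"
    have nz: "N + 1 \<noteq> 0" "N + 2 \<noteq> 0" "N + 3 \<noteq> 0" "2 * N + 3 \<noteq> 0" "N * 2 + 3 \<noteq> 0" "3 + 2 * N \<noteq> 0"
      using N by auto
    show "E * (2 + 2 * N / (N + 2)) + X * 4 = \<kappa> * (4 * ((N + 3) / (N + 1) * ?S 1 + ?S 3))"
      unfolding E X g S1_def[symmetric] S3_def[symmetric] using nz
      by (simp add: divide_simps) (simp add: algebra_simps)
    show "T * (3 * sqrt 2 + sqrt 2 * N / (N + 2)) = \<kappa> * (4 * sqrt 2 * (N + 3) / (N + 2) * ?S 2)"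
      unfolding T g S2_def[symmetric] s_def[symmetric] using nz
      by (simp add: divide_simps) (simp add: algebra_simps)
    show "T * (3 * sqrt 2 - sqrt 2 * N / (N + 1)) = \<kappa> * (2 * sqrt 2 * (N + 3) / (N + 1) * ?S 2)"
      unfolding T g S2_def[symmetric] s_def[symmetric] using nz
      by (simp add: divide_simps) (simp add: algebra_simps)
    show "E * (2 - N / (N + 1)) + X = \<kappa> * (((N + 3) / (N + 1))\<^sup>2 * ?S 1 + ?S 3)"
      unfolding E X g S1_def[symmetric] S3_def[symmetric] using nz
      by (simp add: divide_simps power2_eq_square) (simp add: algebra_simps)
  qed
  have "c *\<^sub>R F = E *\<^sub>R cmat2 (2 + 2 * N / (N + 2)) 0 0 (2 - N / (N + 1))
    + T *\<^sub>R cmat2 0 (3 * sqrt 2 + sqrt 2 * N / (N + 2)) (3 * sqrt 2 - sqrt 2 * N / (N + 1)) 0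
    + X *\<^sub>R cmat2 4 0 0 1"
    by (simp add: F scaleR_add_right E_def T_def X_def)
  also have "\<dots> = cmat2 (E * (2 + 2 * N / (N + 2)) + X * 4) (T * (3 * sqrt 2 + sqrt 2 * N / (N + 2)))
      (T * (3 * sqrt 2 - sqrt 2 * N / (N + 1))) (E * (2 - N / (N + 1)) + X)"
    unfolding cmat2_eq_iff by (simp add: scaleR_conv_of_real[where ?'a = complex])
  also have "\<dots> = \<kappa> *\<^sub>R cmat2 (4 * ((N + 3) / (N + 1) * ?S 1 + ?S 3)) (4 * sqrt 2 * (N + 3) / (N + 2) * ?S 2)
      (2 * sqrt 2 * (N + 3) / (N + 1) * ?S 2) (((N + 3) / (N + 1))\<^sup>2 * ?S 1 + ?S 3)"
    unfolding entries vec_eq_iff forall_2 by (simp add: scaleR_conv_of_real[where ?'a = complex])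
  also have "\<dots> = meval (P n) x ** W1 x"
    unfolding monic_MOPs_W1_chebyshev[OF assms] \<kappa>_def N_def ..
  finally have "c *\<^sub>R (F ** matrix_inv (W1 x)) = (meval (P n) x ** W1 x) ** matrix_inv (W1 x)"
    by (simp add: matrix_mult_scaleR_left[symmetric])
  also have "\<dots> = meval (P n) x"
  proof -
    have "W1 x ** matrix_inv (W1 x) = mat 1"
      using someI_ex[OF invertible_W1[OF assms(2), unfolded invertible_def]]
      unfolding matrix_inv_def by blast
    then show ?thesis by (simp add: matrix_mul_assoc[symmetric])
  qed
  finally show ?thesis by (simp add: c_def F_def)
qed

end
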